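(* Let $X$ be a locally compact second countable Hausdorff space, $\sigma : X \to X$ a local homeomorphism and $\phi : X \to \mathbb R$ a continuous function. Assume that $(X,\sigma)$ is cofinal and that $\mathbb P(-\phi) < 0$. Then every $\phi$-conformal measure for $\sigma$ is dissipative.
   Context: $(X,\sigma)$ is cofinal when $X = \bigcup_{i,j \in \mathbb N} \sigma^{-i}(\sigma^j(U))$ for every open non-empty $U \subseteq X$. A $\phi$-conformal measure is a regular non-zero Borel measure $m$ (finite on compact sets) on $X$ such that $m(\sigma(A)) = \int_A e^{\phi}\, dm$ for every Borel set $A \subseteq X$ on which $\sigma$ is injective. A Borel set $D \subseteq X$ is wandering when $D \cap \sigma^{-k}(D) = \emptyset$ for all $k=1,2,3,\dots$. A $\phi$-conformal measure $m$ is dissipative when the conservative part in its Hopf decomposition is an $m$-null set; equivalently, when $X$ is, up to an $m$-null set, the union of a countable collection of wandering Borel sets. For a continuous $\psi : X \to \mathbb R$ put $L_\psi(f)(x) = \sum_{y \in \sigma^{-1}(x)} e^{\psi(y)} f(y)$ for $f \in C_c(X)$ (continuous compactly supported functions). When $(X,\sigma)$ is cofinal, $\mathbb P_x(\psi) = \log\left( \limsup_{n} (L_\psi^n(f)(x))^{1/n}\right) \in [-\infty,\infty]$ (with $\log 0 = -\infty$, $\log\infty=\infty$) does not depend on the choice of non-negative non-zero $f \in C_c(X)$, and $\mathbb P(\psi) = \sup_{x \in X} \mathbb P_x(\psi)$. *)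

theory Defs
  imports "HOL-Analysis.Analysis"
begin

text \<open>
  Throughout, the space is a type of classes \<^class>\<open>second_countable_topology\<close> and \<^class>\<open>t2_space\<close>;
  local compactness is assumed separately, since there is no type class for it.
\<close>

section \<open>Local homeomorphisms and cofinality\<close>

text \<open>A local homeomorphism need not be surjective or globally injective.\<close>

definition local_homeomorphism :: "('a::topological_space \<Rightarrow> 'a) \<Rightarrow> bool" where
  "local_homeomorphism \<sigma> \<longleftrightarrow>
     (\<forall>x. \<exists>U. open U \<and> x \<in> U \<and> open (\<sigma> ` U) \<and> (\<exists>g. homeomorphism U (\<sigma> ` U) \<sigma> g))"

definition cofinal_system :: "('a::topological_space \<Rightarrow> 'a) \<Rightarrow> bool" where
  "cofinal_system \<sigma> \<longleftrightarrow>
     (\<forall>U. open U \<and> U \<noteq> {} \<longrightarrow> UNIV = (\<Union>i::nat. \<Union>j::nat. (\<sigma> ^^ i) -` ((\<sigma> ^^ j) ` U)))"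

section \<open>Conformal measures\<close>

text \<open>
  Outer regularity on Borel sets and inner regularity on open sets. On a locally compact second
  countable Hausdorff space, for measures finite on compact sets, inner regularity then holds on
  all Borel sets.
\<close>

definition regular_borel_measure :: "'a::topological_space measure \<Rightarrow> bool" where
  "regular_borel_measure M \<longleftrightarrow>
     sets M = sets borel \<and>
     (\<forall>K. compact K \<longrightarrow> emeasure M K < \<infinity>) \<and>
     (\<forall>A\<in>sets borel. emeasure M A = (INF U\<in>{U. open U \<and> A \<subseteq> U}. emeasure M U)) \<and>
     (\<forall>U. open U \<longrightarrow> emeasure M U = (SUP K\<in>{K. compact K \<and> K \<subseteq> U}. emeasure M K))"

definition conformal_measure ::
    "('a::topological_space \<Rightarrow> 'a) \<Rightarrow> ('a \<Rightarrow> real) \<Rightarrow> 'a measure \<Rightarrow> bool" where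
  "conformal_measure \<sigma> \<phi> M \<longleftrightarrow>
     regular_borel_measure M \<and> emeasure M UNIV \<noteq> 0 \<and>
     (\<forall>A\<in>sets borel. inj_on \<sigma> A \<longrightarrow>
        emeasure M (\<sigma> ` A) = (\<integral>\<^sup>+x\<in>A. ennreal (exp (\<phi> x)) \<partial>M))"

section \<open>Hopf decomposition and dissipativity\<close>

definition wandering :: "('a::topological_space \<Rightarrow> 'a) \<Rightarrow> 'a set \<Rightarrow> bool" where
  "wandering \<sigma> D \<longleftrightarrow> D \<in> sets borel \<and> (\<forall>k\<ge>1. D \<inter> (\<sigma> ^^ k) -` D = {})"

text \<open>
  \<open>C\<close> is the conservative and \<open>D\<close> the dissipative part; the decomposition is unique
  modulo null sets, see \<open>hopf_decomposition_unique\<close>. Sequences cover the case of finitely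
  many wandering sets because the empty set is wandering.
\<close>

definition hopf_decomposition ::
    "('a::topological_space \<Rightarrow> 'a) \<Rightarrow> 'a measure \<Rightarrow> 'a set \<Rightarrow> 'a set \<Rightarrow> bool" where
  "hopf_decomposition \<sigma> M C D \<longleftrightarrow>
     C \<in> sets borel \<and> D \<in> sets borel \<and> C \<union> D = UNIV \<and> C \<inter> D = {} \<and>
     (\<exists>W::nat \<Rightarrow> 'a set. (\<forall>n. wandering \<sigma> (W n)) \<and> D = (\<Union>n. W n)) \<and>
     (\<forall>W. wandering \<sigma> W \<and> W \<subseteq> C \<longrightarrow> emeasure M W = 0)"

definition dissipative :: "('a::topological_space \<Rightarrow> 'a) \<Rightarrow> 'a measure \<Rightarrow> bool" where
  "dissipative \<sigma> M \<longleftrightarrow> (\<exists>C D. hopf_decomposition \<sigma> M C D \<and> C \<in> null_sets M)"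

lemma wandering_subset:
  assumes "wandering \<sigma> W" "A \<subseteq> W" "A \<in> sets borel"
  shows "wandering \<sigma> A"
  using assms unfolding wandering_def by blast

lemma hopf_decomposition_conservative_subset:
  assumes "sets M = sets borel"
    and "hopf_decomposition \<sigma> M C D" "hopf_decomposition \<sigma> M C' D'"
  shows "C - C' \<in> null_sets M"
proof -
  obtain W where W: "\<And>n::nat. wandering \<sigma> (W n)" "D' = (\<Union>n. W n)"
    using assms(3) unfolding hopf_decomposition_def by blast
  have C: "C \<in> sets borel" and C0: "\<And>V. wandering \<sigma> V \<Longrightarrow> V \<subseteq> C \<Longrightarrow> emeasure M V = 0"
    using assms(2) unfolding hopf_decomposition_def by blast+
  have "C - C' = (\<Union>n. C \<inter> W n)"
  proof -
    have "C' \<union> D' = UNIV" "C' \<inter> D' = {}"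
      using assms(3) unfolding hopf_decomposition_def by simp_all
    then have "C - C' = C \<inter> D'" by auto
    then show ?thesis unfolding W(2) by simp
  qed
  moreover have "C \<inter> W n \<in> null_sets M" for n
  proof -
    have m: "C \<inter> W n \<in> sets borel"
      using C W(1)[of n] unfolding wandering_def by auto
    then have "wandering \<sigma> (C \<inter> W n)"
      by (rule wandering_subset[OF W(1) Int_lower2])
    then show ?thesis
      using C0 m assms(1) by (auto simp: null_sets_def)
  qed
  ultimately show ?thesis
    by (simp only:) (rule null_sets_UN)
qed

lemma hopf_decomposition_unique:
  assumes "sets M = sets borel"
    and "hopf_decomposition \<sigma> M C D" "hopf_decomposition \<sigma> M C' D'"
  shows "sym_diff C C' \<in> null_sets M"
  by (intro null_sets.Un hopf_decomposition_conservative_subset[OF assms(1,2,3)]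
      hopf_decomposition_conservative_subset[OF assms(1,3,2)])

lemma dissipative_iff_wandering_cover:
  assumes "sets M = sets borel"
  shows "dissipative \<sigma> M \<longleftrightarrow>
    (\<exists>W::nat \<Rightarrow> 'a::topological_space set. (\<forall>n. wandering \<sigma> (W n)) \<and> UNIV - (\<Union>n. W n) \<in> null_sets M)"
proof
  assume "dissipative \<sigma> M"
  then obtain C D where H: "hopf_decomposition \<sigma> M C D" and N: "C \<in> null_sets M"
    unfolding dissipative_def by blast
  from H obtain W :: "nat \<Rightarrow> 'a set" where W: "\<forall>n. wandering \<sigma> (W n)" and D: "D = (\<Union>n. W n)"
    unfolding hopf_decomposition_def by blast
  from H have "C \<union> D = UNIV" "C \<inter> D = {}"
    unfolding hopf_decomposition_def by simp_all
  then have "UNIV - D = C" by auto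
  with W D N show "\<exists>W::nat \<Rightarrow> 'a set. (\<forall>n. wandering \<sigma> (W n)) \<and> UNIV - (\<Union>n. W n) \<in> null_sets M"
    by (intro exI[of _ W]) simp
next
  assume "\<exists>W::nat \<Rightarrow> 'a set. (\<forall>n. wandering \<sigma> (W n)) \<and> UNIV - (\<Union>n. W n) \<in> null_sets M"
  then obtain W :: "nat \<Rightarrow> 'a set" where W: "\<forall>n. wandering \<sigma> (W n)"
    and N: "UNIV - (\<Union>n. W n) \<in> null_sets M" by auto
  define D where "D = (\<Union>n. W n)"
  have D: "D \<in> sets borel"
    unfolding D_def using W by (intro sets.countable_UN) (auto simp: wandering_def)
  have N': "- D \<in> null_sets M"
    using N by (simp add: D_def Compl_eq_Diff_UNIV)
  have "emeasure M V = 0" if "wandering \<sigma> V" "V \<subseteq> - D" for V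
  proof -
    have "V \<in> sets M"
      using that(1) assms unfolding wandering_def by simp
    then show ?thesis
      using null_sets_subset[OF N' _ that(2)] by (simp add: null_sets_def)
  qed
  moreover have "- D \<in> sets borel"
    using D by (rule borel_comp)
  moreover have "- D \<union> D = UNIV" "- D \<inter> D = {}"
    by auto
  moreover have "\<exists>W::nat \<Rightarrow> 'a set. (\<forall>n. wandering \<sigma> (W n)) \<and> D = (\<Union>n. W n)"
    using W D_def by (intro exI[of _ W] conjI)
  ultimately have "hopf_decomposition \<sigma> M (- D) D"
    unfolding hopf_decomposition_def using D by simp
  then show "dissipative \<sigma> M"
    using N' unfolding dissipative_def by blast
qed

section \<open>Transfer operator and pressure\<close>

definition cc_functions :: "('a::topological_space \<Rightarrow> real) set" where
  "cc_functions = {f. continuous_on UNIV f \<and> compact (closure {x. f x \<noteq> 0})}"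

text \<open>
  For \<open>f\<close> in \<^const>\<open>cc_functions\<close> and a local homeomorphism \<open>\<sigma>\<close> only finitely many terms of
  the sum are non-zero, although \<open>\<sigma> -` {x}\<close> itself may be infinite.
\<close>

definition transfer_operator ::
    "('a \<Rightarrow> 'a) \<Rightarrow> ('a \<Rightarrow> real) \<Rightarrow> ('a \<Rightarrow> real) \<Rightarrow> 'a \<Rightarrow> real" where
  "transfer_operator \<sigma> \<psi> f x = (\<Sum>\<^sub>\<infinity>y\<in>\<sigma> -` {x}. exp (\<psi> y) * f y)"

definition ereal_ln :: "ereal \<Rightarrow> ereal" where
  "ereal_ln r = (if r \<le> 0 then -\<infinity> else if r = \<infinity> then \<infinity> else ereal (ln (real_of_ereal r)))"

definition pressure_of ::
    "('a \<Rightarrow> 'a) \<Rightarrow> ('a \<Rightarrow> real) \<Rightarrow> ('a \<Rightarrow> real) \<Rightarrow> 'a \<Rightarrow> ereal" where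
  "pressure_of \<sigma> \<psi> f x =
     ereal_ln (limsup (\<lambda>n. ereal (root n ((transfer_operator \<sigma> \<psi> ^^ n) f x))))"

text \<open>
  When the system is cofinal, the value of \<^const>\<open>pressure_of\<close> at a point does not depend on the
  choice of the non-negative non-zero function, so an arbitrary one is fixed. On a locally compact
  Hausdorff space such functions exist.
\<close>

definition pressure_at ::
    "('a::topological_space \<Rightarrow> 'a) \<Rightarrow> ('a \<Rightarrow> real) \<Rightarrow> 'a \<Rightarrow> ereal" where
  "pressure_at \<sigma> \<psi> x =
     pressure_of \<sigma> \<psi> (SOME f. f \<in> cc_functions \<and> (\<forall>y. 0 \<le> f y) \<and> (\<exists>y. f y \<noteq> 0)) x"

definition pressure :: "('a::topological_space \<Rightarrow> 'a) \<Rightarrow> ('a \<Rightarrow> real) \<Rightarrow> ereal" where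
  "pressure \<sigma> \<psi> = (SUP x. pressure_at \<sigma> \<psi> x)"

end

theory Submission
  imports Defs
begin

text \<open>
  Conformality says that the transfer operator \<open>L\<close> with potential \<open>- \<phi>\<close> satisfies
  \<open>\<integral> L\<^sup>n f \<cdot> g dm = \<integral> f \<cdot> (g \<circ> \<sigma>\<^sup>n) dm\<close>. Negative pressure makes
  \<open>S = \<Sum>\<^sub>n L\<^sup>n f\<close> finite everywhere (root test), so there is a strictly positive \<open>g\<close> with
  \<open>\<integral> S g dm < \<infinity>\<close>, and then \<open>G = \<Sum>\<^sub>n g \<circ> \<sigma>\<^sup>n\<close> is finite almost everywhere on the open set
  \<open>{f \<noteq> 0}\<close>. As \<open>{G = \<infinity>}\<close> is completely invariant, cofinality makes it a null set. Where \<open>G\<close> is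
  finite it strictly decreases along orbits, so the sets \<open>{G \<circ> \<sigma> \<le> q < G < \<infinity>}\<close> with \<open>q\<close> rational are
  wandering, and they cover \<open>{G < \<infinity>}\<close>.
\<close>

section \<open>Local homeomorphisms: Borel images, injective pieces, finite fibres\<close>

text \<open>A continuous image of a Borel set need not be Borel. Here the image is also a preimage,
  taken under the local inverse \<open>g\<close>, which is continuous on an open set.\<close>

lemma local_homeomorphism_borel_image:
  fixes \<sigma> :: "'a::topological_space \<Rightarrow> 'a"
  assumes "open (\<sigma> ` U)" "homeomorphism U (\<sigma> ` U) \<sigma> g" "A \<in> sets borel"
  shows "\<sigma> ` (A \<inter> U) \<in> sets borel"
proof -
  have g: "continuous_on (\<sigma> ` U) g" and gU: "\<And>y. y \<in> U \<Longrightarrow> g (\<sigma> y) = y"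
    using assms(2) by (auto simp: homeomorphism_def)
  have "g \<in> borel_measurable (restrict_space borel (\<sigma> ` U))"
    using g by (rule borel_measurable_continuous_on_restrict)
  from measurable_sets[OF this assms(3)]
  have "g -` A \<inter> \<sigma> ` U \<in> sets (restrict_space borel (\<sigma> ` U))"
    by (simp add: space_restrict_space)
  then have "g -` A \<inter> \<sigma> ` U \<in> sets borel"
    using assms(1) by (subst (asm) sets_restrict_space_iff) auto
  moreover have "g -` A \<inter> \<sigma> ` U = \<sigma> ` (A \<inter> U)"
    using gU by auto
  ultimately show ?thesis by simp
qed

text \<open>Conformality speaks only of Borel sets on which \<open>\<sigma>\<close> is injective. A
  countable partition into such pieces, cut out of a Lindelof subcover by homeomorphic charts, lets
  statements about the measure be proved piece by piece and then summed.\<close>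

lemma local_homeomorphism_partition:
  fixes \<sigma> :: "'a::second_countable_topology \<Rightarrow> 'a"
  assumes "local_homeomorphism \<sigma>"
  obtains V :: "nat \<Rightarrow> 'a set"
  where "disjoint_family V" "(\<Union>i. V i) = UNIV" "\<And>i. V i \<in> sets borel"
    "\<And>i. inj_on \<sigma> (V i)" "\<And>i A. A \<in> sets borel \<Longrightarrow> \<sigma> ` (A \<inter> V i) \<in> sets borel"
proof -
  define F where "F = {U. open U \<and> open (\<sigma> ` U) \<and> (\<exists>g. homeomorphism U (\<sigma> ` U) \<sigma> g)}"
  obtain F' where F': "F' \<subseteq> F" "countable F'" "\<Union>F' = \<Union>F"
    by (rule Lindelof[of F]) (auto simp: F_def)
  have "\<Union>F = UNIV"
    using assms unfolding F_def local_homeomorphism_def by blast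
  with F' have UN: "\<Union>F' = UNIV" by simp
  then have "F' \<noteq> {}" by auto
  \<comment> \<open>If \<open>F'\<close> is finite, this enumeration repeats members;
    \<open>disjointed\<close> turns the repetitions into empty pieces.\<close>
  define U where "U = from_nat_into F'"
  have rU: "range U = F'"
    using F' \<open>F' \<noteq> {}\<close> by (simp add: U_def range_from_nat_into)
  have UF: "U i \<in> F" for i
    using rU F'(1) by blast
  have Uo: "open (U i)" for i
    using UF by (auto simp: F_def)
  define V where "V = disjointed U"
  have VU: "V i \<subseteq> U i" for i
    by (simp add: V_def disjointed_subset)
  have Vb: "V i \<in> sets borel" for i
  proof -
    have "range U \<subseteq> sets borel" using Uo by auto
    then have "range V \<subseteq> sets borel"
      unfolding V_def by (rule sets.range_disjointed_sets)
    then show ?thesis by auto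
  qed
  have inj: "inj_on \<sigma> (V i)" for i
  proof -
    have "inj_on \<sigma> (U i)"
      using UF[of i] unfolding F_def homeomorphism_def by (auto intro: inj_on_inverseI)
    then show ?thesis using VU by (rule inj_on_subset)
  qed
  have img: "\<sigma> ` (A \<inter> V i) \<in> sets borel" if "A \<in> sets borel" for i A
  proof -
    obtain g where "open (\<sigma> ` U i)" "homeomorphism (U i) (\<sigma> ` U i) \<sigma> g"
      using UF[of i] unfolding F_def by blast
    then have "\<sigma> ` ((A \<inter> V i) \<inter> U i) \<in> sets borel"
      using that Vb by (intro local_homeomorphism_borel_image) auto
    moreover have "(A \<inter> V i) \<inter> U i = A \<inter> V i" using VU by auto
    ultimately show ?thesis by simp
  qed
  show ?thesis
    by (rule that[of V])
      (use Vb inj img UN rU in \<open>auto simp: V_def disjoint_family_disjointed UN_disjointed_eq\<close>)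
qed

lemma local_homeomorphism_continuous:
  assumes "local_homeomorphism \<sigma>"
  shows "continuous_on UNIV \<sigma>"
proof -
  have "continuous_on (\<Union>{U. open U \<and> continuous_on U \<sigma>}) \<sigma>"
    by (rule continuous_on_open_Union) auto
  moreover have "\<Union>{U. open U \<and> continuous_on U \<sigma>} = UNIV"
    using assms unfolding local_homeomorphism_def homeomorphism_def by blast
  ultimately show ?thesis by simp
qed

text \<open>By compactness, finitely many open sets on which \<open>\<sigma>\<close> is injective
  cover \<open>K\<close>, and each contains at most one point of the fibre. This makes the sum in
  \<open>transfer_operator\<close> finite for compactly supported functions.\<close>

lemma local_homeomorphism_finite_fibre:
  assumes "local_homeomorphism \<sigma>" "compact K"
  shows "finite (K \<inter> \<sigma> -` {x})"
proof -
  define F where "F = {U. open U \<and> inj_on \<sigma> U}"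
  have "\<exists>U\<in>F. y \<in> U" for y
  proof -
    obtain U g where "open U" "y \<in> U" "homeomorphism U (\<sigma> ` U) \<sigma> g"
      using assms(1) unfolding local_homeomorphism_def by blast
    then show ?thesis
      unfolding F_def homeomorphism_def by (auto intro: inj_on_inverseI)
  qed
  then have "K \<subseteq> \<Union>F" by blast
  then obtain F' where F': "F' \<subseteq> F" "finite F'" "K \<subseteq> \<Union>F'"
    by (rule compactE[OF assms(2)]) (auto simp: F_def)
  have "finite (U \<inter> \<sigma> -` {x})" if "U \<in> F'" for U
  proof -
    have "inj_on \<sigma> (U \<inter> \<sigma> -` {x})"
      using F'(1) that by (auto simp: F_def intro: inj_on_subset)
    moreover have "finite (\<sigma> ` (U \<inter> \<sigma> -` {x}))"
      by (rule finite_subset[of _ "{x}"]) auto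
    ultimately show ?thesis
      using finite_imageD by blast
  qed
  then have "finite (\<Union>U\<in>F'. U \<inter> \<sigma> -` {x})"
    using F'(2) by blast
  moreover have "K \<inter> \<sigma> -` {x} \<subseteq> (\<Union>U\<in>F'. U \<inter> \<sigma> -` {x})"
    using F'(3) by blast
  ultimately show ?thesis by (rule finite_subset[rotated])
qed

section \<open>The transfer operator on extended non-negative functions\<close>

text \<open>Over the reals a divergent \<open>infsum\<close> defaults to 0. With values in
  \<open>ennreal\<close> the sum over a possibly infinite fibre always has its true value, and
  Tonelli applies without summability conditions.\<close>

definition transfer_nn ::
    "('a \<Rightarrow> 'a) \<Rightarrow> ('a \<Rightarrow> real) \<Rightarrow> ('a \<Rightarrow> ennreal) \<Rightarrow> 'a \<Rightarrow> ennreal" where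
  "transfer_nn \<sigma> \<psi> f x = (\<integral>\<^sup>+y. ennreal (exp (\<psi> y)) * f y \<partial>count_space (\<sigma> -` {x}))"

text \<open>The function g \<circ> \<sigma> is constant on the fibre over \<open>x\<close>, so it
  leaves the sum as a factor. This identity drives the duality formula for iterates.\<close>

lemma transfer_nn_mult_comp:
  "transfer_nn \<sigma> \<psi> (\<lambda>y. f y * g (\<sigma> y)) x = transfer_nn \<sigma> \<psi> f x * g x"
proof -
  have "transfer_nn \<sigma> \<psi> (\<lambda>y. f y * g (\<sigma> y)) x =
      (\<integral>\<^sup>+y. (ennreal (exp (\<psi> y)) * f y) * g x \<partial>count_space (\<sigma> -` {x}))"
    unfolding transfer_nn_def by (intro nn_integral_cong) (auto simp: mult.assoc)
  also have "\<dots> = transfer_nn \<sigma> \<psi> f x * g x"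
    unfolding transfer_nn_def by (rule nn_integral_multc) simp
  finally show ?thesis .
qed

lemma transfer_nn_partition:
  fixes V :: "nat \<Rightarrow> 'a set"
  assumes "disjoint_family V" "(\<Union>i. V i) = UNIV"
  shows "transfer_nn \<sigma> \<psi> f x = (\<Sum>i. transfer_nn \<sigma> \<psi> (\<lambda>y. f y * indicator (V i) y) x)"
proof -
  have "(\<Sum>i. indicator (V i) y) = (1::ennreal)" for y
    using suminf_indicator[OF assms(1), where x = y] assms(2) by simp
  then have "transfer_nn \<sigma> \<psi> f x =
      (\<integral>\<^sup>+y. (\<Sum>i. ennreal (exp (\<psi> y)) * (f y * indicator (V i) y)) \<partial>count_space (\<sigma> -` {x}))"
    unfolding transfer_nn_def by (simp add: mult.assoc[symmetric])
  also have "\<dots> = (\<Sum>i. transfer_nn \<sigma> \<psi> (\<lambda>y. f y * indicator (V i) y) x)"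
    unfolding transfer_nn_def by (rule nn_integral_suminf) simp
  finally show ?thesis .
qed

text \<open>The fibre meets \<open>V\<close> in at most one point, so only the term along the
  inverse branch survives. Off the image of \<open>V\<close> the value of
  \<open>the_inv_into\<close> is arbitrary, and the indicator removes it.\<close>

lemma transfer_nn_inj_on:
  assumes "inj_on \<sigma> V"
  shows "transfer_nn \<sigma> \<psi> (\<lambda>y. f y * indicator V y) x =
    ennreal (exp (\<psi> (the_inv_into V \<sigma> x))) * f (the_inv_into V \<sigma> x) * indicator (\<sigma> ` V) x"
proof (cases "x \<in> \<sigma> ` V")
  case True
  then obtain v where v: "v \<in> V" "x = \<sigma> v" by blast
  have "transfer_nn \<sigma> \<psi> (\<lambda>y. f y * indicator V y) x =
      (\<Sum>y\<in>{v}. ennreal (exp (\<psi> y)) * (f y * indicator V y))"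
    unfolding transfer_nn_def
  proof (rule nn_integral_count_space')
    fix y assume "y \<in> \<sigma> -` {x}" "y \<notin> {v}"
    then have "y \<notin> V"
      using assms v by (auto dest: inj_onD)
    then show "ennreal (exp (\<psi> y)) * (f y * indicator V y) = 0" by simp
  qed (use v in auto)
  then show ?thesis by (simp add: v the_inv_into_f_f[OF assms v(1)])
next
  case False
  have "transfer_nn \<sigma> \<psi> (\<lambda>y. f y * indicator V y) x = (\<integral>\<^sup>+y. 0 \<partial>count_space (\<sigma> -` {x}))"
    unfolding transfer_nn_def
    by (intro nn_integral_cong) (use False in \<open>auto simp: indicator_def\<close>)
  then show ?thesis using False by simp
qed

lemma borel_measurable_the_inv_into:
  assumes "V \<in> sets borel" "inj_on \<sigma> V" "\<And>A. A \<in> sets borel \<Longrightarrow> \<sigma> ` (A \<inter> V) \<in> sets borel"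
  shows "the_inv_into V \<sigma> \<in> borel_measurable (restrict_space borel (\<sigma> ` V))"
proof (rule measurableI)
  fix A :: "'a set" assume A: "A \<in> sets borel"
  have eq: "the_inv_into V \<sigma> -` A \<inter> \<sigma> ` V = \<sigma> ` (A \<inter> V)"
    using assms(2) by (auto simp: the_inv_into_f_f)
  have "\<sigma> ` V \<in> sets borel"
    using assms(3)[of UNIV] by simp
  then show "the_inv_into V \<sigma> -` A \<inter> space (restrict_space borel (\<sigma> ` V)) \<in>
      sets (restrict_space borel (\<sigma> ` V))"
    using assms(3)[OF A] by (subst sets_restrict_space_iff) (auto simp: space_restrict_space eq)
qed simp

lemma borel_measurable_transfer_nn_inj_on:
  assumes "V \<in> sets borel" "inj_on \<sigma> V" "\<And>A. A \<in> sets borel \<Longrightarrow> \<sigma> ` (A \<inter> V) \<in> sets borel"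
    and "\<psi> \<in> borel_measurable borel" "f \<in> borel_measurable borel"
  shows "transfer_nn \<sigma> \<psi> (\<lambda>y. f y * indicator V y) \<in> borel_measurable borel"
proof -
  have V: "\<sigma> ` V \<in> sets borel"
    using assms(3)[of UNIV] by simp
  have "the_inv_into V \<sigma> \<in> borel_measurable (restrict_space borel (\<sigma> ` V))"
    by (rule borel_measurable_the_inv_into) (use assms in auto)
  note [measurable] = this assms(4,5)
  have "(\<lambda>x. ennreal (exp (\<psi> (the_inv_into V \<sigma> x))) * f (the_inv_into V \<sigma> x))
      \<in> borel_measurable (restrict_space borel (\<sigma> ` V))"
    by measurable
  then have "(\<lambda>x. ennreal (exp (\<psi> (the_inv_into V \<sigma> x))) * f (the_inv_into V \<sigma> x) * indicator (\<sigma> ` V) x)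
      \<in> borel_measurable borel"
    by (subst (asm) borel_measurable_restrict_space_iff_ennreal) (use V in auto)
  then show ?thesis
    by (simp add: transfer_nn_inj_on[OF assms(2)] cong: measurable_cong)
qed

lemma borel_measurable_transfer_nn:
  fixes \<sigma> :: "'a::second_countable_topology \<Rightarrow> 'a"
  assumes "local_homeomorphism \<sigma>" "\<psi> \<in> borel_measurable borel" "f \<in> borel_measurable borel"
  shows "transfer_nn \<sigma> \<psi> f \<in> borel_measurable borel"
proof -
  obtain V :: "nat \<Rightarrow> 'a set" where V: "disjoint_family V" "(\<Union>i. V i) = UNIV"
    "\<And>i. V i \<in> sets borel" "\<And>i. inj_on \<sigma> (V i)"
    "\<And>i A. A \<in> sets borel \<Longrightarrow> \<sigma> ` (A \<inter> V i) \<in> sets borel"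
    by (rule local_homeomorphism_partition[OF assms(1)]) blast
  have "transfer_nn \<sigma> \<psi> f = (\<lambda>x. \<Sum>i. transfer_nn \<sigma> \<psi> (\<lambda>y. f y * indicator (V i) y) x)"
    by (intro ext transfer_nn_partition V)
  also have "\<dots> \<in> borel_measurable borel"
    by (intro borel_measurable_suminf_order borel_measurable_transfer_nn_inj_on V assms)
  finally show ?thesis .
qed

lemma borel_measurable_transfer_nn_funpow:
  fixes \<sigma> :: "'a::second_countable_topology \<Rightarrow> 'a"
  assumes "local_homeomorphism \<sigma>" "\<psi> \<in> borel_measurable borel" "f \<in> borel_measurable borel"
  shows "(transfer_nn \<sigma> \<psi> ^^ n) f \<in> borel_measurable borel"
  by (induction n) (use assms in \<open>auto intro: borel_measurable_transfer_nn\<close>)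

section \<open>Duality with a conformal measure\<close>

lemma conformal_measure_sets: "conformal_measure \<sigma> \<phi> M \<Longrightarrow> sets M = sets borel"
  by (simp add: conformal_measure_def regular_borel_measure_def)

lemma conformal_measure_image:
  assumes "conformal_measure \<sigma> \<phi> M" "A \<in> sets borel" "inj_on \<sigma> A"
  shows "emeasure M (\<sigma> ` A) = (\<integral>\<^sup>+x. ennreal (exp (\<phi> x)) * indicator A x \<partial>M)"
  using assms by (simp add: conformal_measure_def)

text \<open>Conformality, applied to every A \<inter> V, says that pushing the measure on the image
  of \<open>V\<close> forward along the inverse branch gives the density e^\<phi> on
  \<open>V\<close>. The weight e^(-\<phi>) of the operator cancels this density.\<close>

lemma nn_integral_transfer_nn_inj_on:
  assumes M: "conformal_measure \<sigma> \<phi> M"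
    and V: "V \<in> sets borel" "inj_on \<sigma> V" "\<And>A. A \<in> sets borel \<Longrightarrow> \<sigma> ` (A \<inter> V) \<in> sets borel"
    and meas: "\<phi> \<in> borel_measurable borel" "f \<in> borel_measurable borel"
  shows "(\<integral>\<^sup>+x. transfer_nn \<sigma> (\<lambda>x. - \<phi> x) (\<lambda>y. f y * indicator V y) x \<partial>M) =
    (\<integral>\<^sup>+x. f x * indicator V x \<partial>M)"
proof -
  note sM[measurable_cong, simp] = conformal_measure_sets[OF M]
  have spM: "space M = UNIV" using sets_eq_imp_space_eq[OF sM] by simp
  note [measurable] = meas V(1)
  define g where "g = the_inv_into V \<sigma>"
  \<comment> \<open>The inverse branch is known to be measurable only on the image of
    \<open>V\<close>, so the measure is restricted to that set before it is pushed forward.\<close>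
  define R where "R = restrict_space M (\<sigma> ` V)"
  have sV: "\<sigma> ` V \<in> sets M"
    using V(3)[of UNIV] by simp
  have sR: "sets R = sets (restrict_space borel (\<sigma> ` V))"
    unfolding R_def by (rule sets_restrict_space_cong) simp
  have gR: "g \<in> measurable R borel"
    unfolding measurable_cong_sets[OF sR refl] g_def by (rule borel_measurable_the_inv_into[OF V])
  have eq: "distr R borel g = density M (\<lambda>x. ennreal (exp (\<phi> x)) * indicator V x)"
  proof (rule measure_eqI)
    fix A assume "A \<in> sets (distr R borel g)"
    then have A[measurable]: "A \<in> sets borel" by simp
    have "g -` A \<inter> \<sigma> ` V = \<sigma> ` (A \<inter> V)"
      using V(2) by (auto simp: the_inv_into_f_f g_def)
    then have "emeasure (distr R borel g) A = emeasure M (\<sigma> ` (A \<inter> V))"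
      using gR A by (subst emeasure_distr)
        (auto simp: R_def space_restrict_space spM intro!: emeasure_restrict_space sV[unfolded sM])
    also have "\<dots> = (\<integral>\<^sup>+x. ennreal (exp (\<phi> x)) * indicator (A \<inter> V) x \<partial>M)"
      by (rule conformal_measure_image[OF M]) (use V in \<open>auto intro: inj_on_subset\<close>)
    also have "\<dots> = emeasure (density M (\<lambda>x. ennreal (exp (\<phi> x)) * indicator V x)) A"
      by (subst emeasure_density) (auto intro!: nn_integral_cong split: split_indicator)
    finally show "emeasure (distr R borel g) A = \<dots>" .
  qed simp
  have "(\<integral>\<^sup>+x. transfer_nn \<sigma> (\<lambda>x. - \<phi> x) (\<lambda>y. f y * indicator V y) x \<partial>M) =
      (\<integral>\<^sup>+x. ennreal (exp (- \<phi> (g x))) * f (g x) \<partial>R)"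
    unfolding transfer_nn_inj_on[OF V(2)] R_def g_def
    by (rule nn_integral_restrict_space[symmetric]) (use sV in \<open>auto simp: spM\<close>)
  also have "\<dots> = (\<integral>\<^sup>+x. ennreal (exp (- \<phi> x)) * f x \<partial>distr R borel g)"
    by (subst nn_integral_distr[OF gR]) auto
  also have "\<dots> = (\<integral>\<^sup>+x. ennreal (exp (\<phi> x)) * indicator V x * (ennreal (exp (- \<phi> x)) * f x) \<partial>M)"
    unfolding eq by (rule nn_integral_density) auto
  also have "\<dots> = (\<integral>\<^sup>+x. f x * indicator V x \<partial>M)"
  proof (rule nn_integral_cong)
    fix x
    have "ennreal (exp (\<phi> x)) * ennreal (exp (- \<phi> x)) = 1"
      by (simp add: ennreal_mult[symmetric] exp_minus)
    then show "ennreal (exp (\<phi> x)) * indicator V x * (ennreal (exp (- \<phi> x)) * f x) = f x * indicator V x"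
      by (auto split: split_indicator simp: mult.assoc[symmetric])
  qed
  finally show ?thesis .
qed

text \<open>The conformal measure is fixed by the dual of the transfer operator: summing the
  one-piece identity over the partition removes the injectivity restriction.\<close>

lemma nn_integral_transfer_nn:
  fixes \<sigma> :: "'a::second_countable_topology \<Rightarrow> 'a"
  assumes \<sigma>: "local_homeomorphism \<sigma>" and M: "conformal_measure \<sigma> \<phi> M"
    and meas: "\<phi> \<in> borel_measurable borel" "f \<in> borel_measurable borel"
  shows "(\<integral>\<^sup>+x. transfer_nn \<sigma> (\<lambda>x. - \<phi> x) f x \<partial>M) = (\<integral>\<^sup>+x. f x \<partial>M)"
proof -
  note sM[measurable_cong] = conformal_measure_sets[OF M]
  obtain V :: "nat \<Rightarrow> 'a set" where V: "disjoint_family V" "(\<Union>i. V i) = UNIV"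
    "\<And>i. V i \<in> sets borel" "\<And>i. inj_on \<sigma> (V i)"
    "\<And>i A. A \<in> sets borel \<Longrightarrow> \<sigma> ` (A \<inter> V i) \<in> sets borel"
    by (rule local_homeomorphism_partition[OF \<sigma>]) blast
  note [measurable] = meas V(3)
  let ?T = "\<lambda>i. transfer_nn \<sigma> (\<lambda>x. - \<phi> x) (\<lambda>y. f y * indicator (V i) y)"
  have T: "?T i \<in> borel_measurable M" for i
    using borel_measurable_transfer_nn_inj_on[OF V(3,4,5), of "\<lambda>x. - \<phi> x" f i] meas
    by (simp add: measurable_cong_sets[OF sM refl])
  have "(\<integral>\<^sup>+x. transfer_nn \<sigma> (\<lambda>x. - \<phi> x) f x \<partial>M) = (\<integral>\<^sup>+x. (\<Sum>i. ?T i x) \<partial>M)"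
    by (simp add: transfer_nn_partition[OF V(1,2), of _ _ f])
  also have "\<dots> = (\<Sum>i. \<integral>\<^sup>+x. ?T i x \<partial>M)"
    by (rule nn_integral_suminf) (rule T)
  also have "\<dots> = (\<Sum>i. \<integral>\<^sup>+x. f x * indicator (V i) x \<partial>M)"
    by (simp add: nn_integral_transfer_nn_inj_on[OF M V(3,4,5) meas])
  also have "\<dots> = (\<integral>\<^sup>+x. (\<Sum>i. f x * indicator (V i) x) \<partial>M)"
    by (rule nn_integral_suminf[symmetric]) measurable
  also have "\<dots> = (\<integral>\<^sup>+x. f x \<partial>M)"
  proof (rule nn_integral_cong)
    fix x
    show "(\<Sum>i. f x * indicator (V i) x) = f x"
      using suminf_indicator[OF V(1), where x = x] V(2) by simp
  qed
  finally show ?thesis .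
qed

text \<open>Each induction step trades one application of the operator for one composition of
  \<open>g\<close> with \<open>\<sigma>\<close>. The induction hypothesis is then used for g \<circ>
  \<sigma>, so \<open>g\<close> must be arbitrary.\<close>

lemma nn_integral_transfer_nn_funpow:
  fixes \<sigma> :: "'a::second_countable_topology \<Rightarrow> 'a"
  assumes \<sigma>: "local_homeomorphism \<sigma>" and M: "conformal_measure \<sigma> \<phi> M"
    and meas: "\<phi> \<in> borel_measurable borel" "f \<in> borel_measurable borel" "g \<in> borel_measurable borel"
  shows "(\<integral>\<^sup>+x. (transfer_nn \<sigma> (\<lambda>x. - \<phi> x) ^^ n) f x * g x \<partial>M) =
    (\<integral>\<^sup>+x. f x * g ((\<sigma> ^^ n) x) \<partial>M)"
  using meas(3)
proof (induction n arbitrary: g)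
  case (Suc n)
  note [measurable] = borel_measurable_continuous_onI[OF local_homeomorphism_continuous[OF \<sigma>]]
    Suc.prems meas
  let ?F = "(transfer_nn \<sigma> (\<lambda>x. - \<phi> x) ^^ n) f"
  have [measurable]: "?F \<in> borel_measurable borel"
    by (rule borel_measurable_transfer_nn_funpow[OF \<sigma>]) (use meas in auto)
  have "(\<integral>\<^sup>+x. (transfer_nn \<sigma> (\<lambda>x. - \<phi> x) ^^ Suc n) f x * g x \<partial>M) =
      (\<integral>\<^sup>+x. transfer_nn \<sigma> (\<lambda>x. - \<phi> x) (\<lambda>y. ?F y * g (\<sigma> y)) x \<partial>M)"
    by (simp add: transfer_nn_mult_comp)
  also have "\<dots> = (\<integral>\<^sup>+x. ?F x * g (\<sigma> x) \<partial>M)"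
    by (rule nn_integral_transfer_nn[OF \<sigma> M]) (use meas in measurable)
  also have "\<dots> = (\<integral>\<^sup>+x. f x * g (\<sigma> ((\<sigma> ^^ n) x)) \<partial>M)"
    by (rule Suc.IH) measurable
  finally show ?case by simp
qed simp

section \<open>Null sets of a conformal measure\<close>

text \<open>The density e^\<phi> is strictly positive, so its integral over \<open>A\<close>
  vanishes only when \<open>A\<close> is null.\<close>

lemma conformal_measure_null_image_iff:
  assumes M: "conformal_measure \<sigma> \<phi> M" and \<phi>: "\<phi> \<in> borel_measurable borel"
    and A: "A \<in> sets borel" "inj_on \<sigma> A"
  shows "emeasure M (\<sigma> ` A) = 0 \<longleftrightarrow> emeasure M A = 0"
proof -
  note sM[measurable_cong, simp] = conformal_measure_sets[OF M]
  have spM[simp]: "space M = UNIV" using sets_eq_imp_space_eq[OF sM] by simp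
  note [measurable] = \<phi> A(1)
  have "emeasure M (\<sigma> ` A) = 0 \<longleftrightarrow> (AE x in M. ennreal (exp (\<phi> x)) * indicator A x = 0)"
    unfolding conformal_measure_image[OF M A] by (rule nn_integral_0_iff_AE) measurable
  also have "\<dots> \<longleftrightarrow> (AE x in M. x \<notin> A)"
    by (intro AE_cong) (auto split: split_indicator)
  also have "\<dots> \<longleftrightarrow> emeasure M A = 0"
    using A by (subst AE_iff_measurable[of A]) auto
  finally show ?thesis .
qed

lemma conformal_measure_null_image:
  fixes \<sigma> :: "'a::second_countable_topology \<Rightarrow> 'a"
  assumes \<sigma>: "local_homeomorphism \<sigma>" and M: "conformal_measure \<sigma> \<phi> M"
    and \<phi>: "\<phi> \<in> borel_measurable borel" and A: "A \<in> null_sets M"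
  shows "\<sigma> ` A \<in> null_sets M"
proof -
  note sM[simp] = conformal_measure_sets[OF M]
  obtain V :: "nat \<Rightarrow> 'a set" where V: "disjoint_family V" "(\<Union>i. V i) = UNIV"
    "\<And>i. V i \<in> sets borel" "\<And>i. inj_on \<sigma> (V i)"
    "\<And>i A. A \<in> sets borel \<Longrightarrow> \<sigma> ` (A \<inter> V i) \<in> sets borel"
    by (rule local_homeomorphism_partition[OF \<sigma>]) blast
  have Ab: "A \<in> sets borel" using A by auto
  have "\<sigma> ` (A \<inter> V i) \<in> null_sets M" for i
  proof -
    have "A \<inter> V i \<in> null_sets M"
      using A V(3) by (intro null_set_Int2) auto
    then have "emeasure M (\<sigma> ` (A \<inter> V i)) = 0"
      using V Ab by (subst conformal_measure_null_image_iff[OF M \<phi>]) (auto intro: inj_on_subset)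
    then show ?thesis using V(5)[OF Ab] by (auto simp: null_sets_def)
  qed
  then have "(\<Union>i. \<sigma> ` (A \<inter> V i)) \<in> null_sets M" by (rule null_sets_UN)
  moreover have "(\<Union>i. \<sigma> ` (A \<inter> V i)) = \<sigma> ` (A \<inter> (\<Union>i. V i))" by auto
  ultimately show ?thesis using V(2) by simp
qed

text \<open>Each injective piece of the preimage is mapped into the null set \<open>A\<close>; the
  equivalence for injective pieces carries nullity back to the piece.\<close>

lemma conformal_measure_null_vimage:
  fixes \<sigma> :: "'a::second_countable_topology \<Rightarrow> 'a"
  assumes \<sigma>: "local_homeomorphism \<sigma>" and M: "conformal_measure \<sigma> \<phi> M"
    and \<phi>: "\<phi> \<in> borel_measurable borel" and A: "A \<in> null_sets M"
  shows "\<sigma> -` A \<in> null_sets M"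
proof -
  note sM[simp] = conformal_measure_sets[OF M]
  obtain V :: "nat \<Rightarrow> 'a set" where V: "disjoint_family V" "(\<Union>i. V i) = UNIV"
    "\<And>i. V i \<in> sets borel" "\<And>i. inj_on \<sigma> (V i)"
    "\<And>i A. A \<in> sets borel \<Longrightarrow> \<sigma> ` (A \<inter> V i) \<in> sets borel"
    by (rule local_homeomorphism_partition[OF \<sigma>]) blast
  have Ab: "\<sigma> -` A \<in> sets borel"
    by (rule measurable_sets_borel[OF borel_measurable_continuous_onI])
      (use A in \<open>simp_all add: local_homeomorphism_continuous[OF \<sigma>] null_setsD2[of _ M, unfolded sM]\<close>)
  have "\<sigma> -` A \<inter> V i \<in> null_sets M" for i
  proof -
    have "\<sigma> ` (\<sigma> -` A \<inter> V i) \<in> null_sets M"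
      by (rule null_sets_subset[OF A]) (use V(5)[OF Ab] in auto)
    then have "emeasure M (\<sigma> ` (\<sigma> -` A \<inter> V i)) = 0" by auto
    then have "emeasure M (\<sigma> -` A \<inter> V i) = 0"
      using V Ab by (subst (asm) conformal_measure_null_image_iff[OF M \<phi>]) (auto intro: inj_on_subset)
    then show ?thesis using Ab V(3) by (auto simp: null_sets_def)
  qed
  then have "(\<Union>i. \<sigma> -` A \<inter> V i) \<in> null_sets M" by (rule null_sets_UN)
  moreover have "(\<Union>i. \<sigma> -` A \<inter> V i) = \<sigma> -` A \<inter> (\<Union>i. V i)" by auto
  ultimately show ?thesis using V(2) by simp
qed

text \<open>By cofinality the orbit of any point of \<open>E\<close> merges with that of some point
  of \<open>U\<close>, and invariance in both directions puts the latter in \<open>E\<close>. So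
  \<open>E\<close> lies in a countable union of preimages of forward images of the null set E
  \<inter> U.\<close>

lemma conformal_measure_null_cofinal:
  fixes \<sigma> :: "'a::second_countable_topology \<Rightarrow> 'a"
  assumes \<sigma>: "local_homeomorphism \<sigma>" and cof: "cofinal_system \<sigma>"
    and M: "conformal_measure \<sigma> \<phi> M" and \<phi>: "\<phi> \<in> borel_measurable borel"
    and E: "E \<in> sets borel" "\<And>x. \<sigma> x \<in> E \<longleftrightarrow> x \<in> E"
    and U: "open U" "U \<noteq> {}" "E \<inter> U \<in> null_sets M"
  shows "E \<in> null_sets M"
proof -
  have inv: "(\<sigma> ^^ n) x \<in> E \<longleftrightarrow> x \<in> E" for n x
    by (induction n) (simp_all add: E(2))
  have img: "(\<sigma> ^^ j) ` (E \<inter> U) \<in> null_sets M" for j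
  proof (induction j)
    case (Suc j)
    then show ?case
      using conformal_measure_null_image[OF \<sigma> M \<phi> Suc] by (simp add: image_comp)
  qed (simp add: U)
  have "(\<sigma> ^^ i) -` ((\<sigma> ^^ j) ` (E \<inter> U)) \<in> null_sets M" for i j
  proof (induction i)
    case (Suc i)
    show ?case
      unfolding funpow_Suc_right vimage_comp[symmetric]
      by (rule conformal_measure_null_vimage[OF \<sigma> M \<phi> Suc])
  qed (simp add: img)
  then have "(\<Union>i. \<Union>j. (\<sigma> ^^ i) -` ((\<sigma> ^^ j) ` (E \<inter> U))) \<in> null_sets M"
    by (intro null_sets_UN)
  moreover have "E \<subseteq> (\<Union>i. \<Union>j. (\<sigma> ^^ i) -` ((\<sigma> ^^ j) ` (E \<inter> U)))"
  proof
    fix x assume x: "x \<in> E"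
    have "x \<in> (\<Union>i. \<Union>j. (\<sigma> ^^ i) -` ((\<sigma> ^^ j) ` U))"
      using cof U unfolding cofinal_system_def by blast
    then obtain i j u where u: "u \<in> U" "(\<sigma> ^^ i) x = (\<sigma> ^^ j) u" by auto
    then have "u \<in> E" using x inv by metis
    with u show "x \<in> (\<Union>i. \<Union>j. (\<sigma> ^^ i) -` ((\<sigma> ^^ j) ` (E \<inter> U)))" by blast
  qed
  ultimately show ?thesis
    using E(1) conformal_measure_sets[OF M] by (blast intro: null_sets_subset)
qed

section \<open>Wandering sets from a summable function\<close>

lemma borel_measurable_funpow:
  fixes \<sigma> :: "'a::topological_space \<Rightarrow> 'a"
  assumes "\<sigma> \<in> borel_measurable borel"
  shows "(\<sigma> ^^ n) \<in> borel_measurable borel"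
  by (induction n) (use assms in \<open>auto simp: id_def[symmetric]\<close>)

lemma suminf_funpow_rec:
  fixes g :: "'a \<Rightarrow> ennreal"
  shows "(\<Sum>n. g ((\<sigma> ^^ n) x)) = g x + (\<Sum>n. g ((\<sigma> ^^ n) (\<sigma> x)))"
  by (subst suminf_offset[of _ 1]) (auto simp: funpow_swap1 add.commute)

lemma birkhoff_finite_wandering_cover:
  fixes \<sigma> :: "'a::topological_space \<Rightarrow> 'a" and g :: "'a \<Rightarrow> ennreal"
  defines "G \<equiv> \<lambda>x. \<Sum>n. g ((\<sigma> ^^ n) x)"
  assumes \<sigma>[measurable]: "\<sigma> \<in> borel_measurable borel" and g[measurable]: "g \<in> borel_measurable borel"
    and pos: "\<And>x. 0 < g x"
  shows "\<exists>W::nat \<Rightarrow> 'a set. (\<forall>n. wandering \<sigma> (W n)) \<and> {x. G x < \<infinity>} = (\<Union>n. W n)"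
proof -
  have pow[measurable]: "(\<sigma> ^^ n) \<in> borel_measurable borel" for n
    using \<sigma> by (rule borel_measurable_funpow)
  have G[measurable]: "G \<in> borel_measurable borel"
    unfolding G_def by measurable
  have step: "G x = g x + G (\<sigma> x)" for x
    unfolding G_def by (rule suminf_funpow_rec)
  have dec: "G ((\<sigma> ^^ k) x) \<le> G x" for k x
  proof (induction k)
    case (Suc k)
    have "G ((\<sigma> ^^ Suc k) x) \<le> G ((\<sigma> ^^ k) x)"
      using step[of "(\<sigma> ^^ k) x"] by simp
    with Suc show ?case by order
  qed simp
  \<comment> \<open>\<open>q\<close> is a level that \<open>G\<close> crosses in the first step from
    \<open>x\<close>. As \<open>G\<close> does not increase along orbits, it stays at or below
    \<open>q\<close> afterwards, so the orbit cannot return. Negative \<open>q\<close> is truncated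
    to 0 by \<open>ennreal\<close>, which is harmless.\<close>
  define D where "D q = {x. G (\<sigma> x) \<le> ennreal (of_rat q) \<and> ennreal (of_rat q) < G x \<and> G x < \<infinity>}"
    for q :: rat
  have "wandering \<sigma> (D q)" for q
    unfolding wandering_def
  proof (intro conjI allI impI)
    have "{x \<in> space borel. G (\<sigma> x) \<le> ennreal (of_rat q) \<and> ennreal (of_rat q) < G x \<and> G x < \<infinity>} \<in> sets borel"
      by measurable
    then show "D q \<in> sets borel" by (simp add: D_def)
    fix k :: nat assume "1 \<le> k"
    then obtain l where k: "k = Suc l" by (cases k) auto
    show "D q \<inter> (\<sigma> ^^ k) -` D q = {}"
    proof (rule equals0I)
      fix x assume x: "x \<in> D q \<inter> (\<sigma> ^^ k) -` D q"
      have "G ((\<sigma> ^^ k) x) \<le> G (\<sigma> x)"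
        using dec[of l "\<sigma> x"] by (simp add: k funpow_swap1)
      with x show False by (auto simp: D_def)
    qed
  qed
  moreover have "{x. G x < \<infinity>} = (\<Union>n. D (from_nat n))"
  proof (intro equalityI subsetI)
    fix x assume "x \<in> {x. G x < \<infinity>}"
    then have fin: "G x < \<infinity>" by simp
    have "G (\<sigma> x) < \<infinity>"
      using dec[of 1 x] fin by (auto intro: le_less_trans)
    \<comment> \<open>Finiteness is essential here: adding a positive number to infinity gives no
      strict increase.\<close>
    then have "G (\<sigma> x) + 0 < G (\<sigma> x) + g x"
      using pos[of x] by (subst ennreal_add_left_cancel_less) auto
    then have "G (\<sigma> x) < G x"
      by (simp add: step[of x] add.commute)
    then obtain q :: rat where "G (\<sigma> x) < ennreal (of_rat q)" "ennreal (of_rat q) < G x"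
      using ennreal_rat_dense by blast
    then have "x \<in> D (from_nat (to_nat q))" using fin by (simp add: D_def)
    then show "x \<in> (\<Union>n. D (from_nat n))" by blast
  qed (auto simp: D_def)
  ultimately show ?thesis by (intro exI[of _ "\<lambda>n. D (from_nat n)"]) blast
qed

section \<open>Negative pressure\<close>

text \<open>The three conclusions together allow iteration: the result is again non-negative and
  vanishes outside a compact set, the image of \<open>K\<close>.\<close>

lemma transfer_operator_eq_transfer_nn:
  assumes \<sigma>: "local_homeomorphism \<sigma>" and K: "compact K" "{y. f y \<noteq> 0} \<subseteq> K"
    and nonneg: "\<And>y. 0 \<le> f y"
  shows "ennreal (transfer_operator \<sigma> \<psi> f x) = transfer_nn \<sigma> \<psi> (\<lambda>y. ennreal (f y)) x"
    and "0 \<le> transfer_operator \<sigma> \<psi> f x"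
    and "{x. transfer_operator \<sigma> \<psi> f x \<noteq> 0} \<subseteq> \<sigma> ` K"
proof -
  let ?F = "\<lambda>x. K \<inter> \<sigma> -` {x}"
  have fin: "finite (?F x)" for x
    by (rule local_homeomorphism_finite_fibre[OF \<sigma> K(1)])
  have "transfer_operator \<sigma> \<psi> f x = infsum (\<lambda>y. exp (\<psi> y) * f y) (?F x)" for x
    unfolding transfer_operator_def by (rule infsum_cong_neutral) (use K(2) in auto)
  then have eq: "transfer_operator \<sigma> \<psi> f x = (\<Sum>y\<in>?F x. exp (\<psi> y) * f y)" for x
    using fin by simp
  show "0 \<le> transfer_operator \<sigma> \<psi> f x"
    unfolding eq using nonneg by (intro sum_nonneg) auto
  have "transfer_nn \<sigma> \<psi> (\<lambda>y. ennreal (f y)) x = (\<Sum>y\<in>?F x. ennreal (exp (\<psi> y)) * ennreal (f y))"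
    unfolding transfer_nn_def
  proof (rule nn_integral_count_space'[OF fin])
    fix y assume "y \<in> \<sigma> -` {x}" "y \<notin> ?F x"
    then have "f y = 0" using K(2) by blast
    then show "ennreal (exp (\<psi> y)) * ennreal (f y) = 0" by simp
  qed auto
  also have "\<dots> = ennreal (\<Sum>y\<in>?F x. exp (\<psi> y) * f y)"
    using nonneg by (simp add: ennreal_mult[symmetric] sum_ennreal)
  finally show "ennreal (transfer_operator \<sigma> \<psi> f x) = transfer_nn \<sigma> \<psi> (\<lambda>y. ennreal (f y)) x"
    by (simp add: eq)
  show "{x. transfer_operator \<sigma> \<psi> f x \<noteq> 0} \<subseteq> \<sigma> ` K"
  proof
    fix x assume "x \<in> {x. transfer_operator \<sigma> \<psi> f x \<noteq> 0}"
    then have "?F x \<noteq> {}" by (auto simp: eq)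
    then show "x \<in> \<sigma> ` K" by auto
  qed
qed

lemma transfer_operator_funpow_eq_transfer_nn:
  assumes \<sigma>: "local_homeomorphism \<sigma>" and f: "f \<in> cc_functions" "\<And>y. 0 \<le> f y"
  shows "ennreal ((transfer_operator \<sigma> \<psi> ^^ n) f x) = (transfer_nn \<sigma> \<psi> ^^ n) (\<lambda>y. ennreal (f y)) x"
    and "0 \<le> (transfer_operator \<sigma> \<psi> ^^ n) f x"
proof -
  \<comment> \<open>The operator at \<open>x\<close> reads values at all preimages of
    \<open>x\<close>, so the induction needs equality of functions, together with a compact set
    containing the support.\<close>
  have "(\<lambda>x. ennreal ((transfer_operator \<sigma> \<psi> ^^ n) f x)) = (transfer_nn \<sigma> \<psi> ^^ n) (\<lambda>y. ennreal (f y)) \<and>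
      (\<forall>x. 0 \<le> (transfer_operator \<sigma> \<psi> ^^ n) f x) \<and>
      (\<exists>K. compact K \<and> {x. (transfer_operator \<sigma> \<psi> ^^ n) f x \<noteq> 0} \<subseteq> K)"
  proof (induction n)
    case 0
    then show ?case
      using f closure_subset[of "{x. f x \<noteq> 0}"] by (auto simp: cc_functions_def)
  next
    case (Suc n)
    let ?f = "(transfer_operator \<sigma> \<psi> ^^ n) f"
    obtain K where K: "compact K" "{x. ?f x \<noteq> 0} \<subseteq> K" using Suc by blast
    have nn: "\<And>x. 0 \<le> ?f x" using Suc by blast
    note * = transfer_operator_eq_transfer_nn[OF \<sigma> K nn, where \<psi> = \<psi>]
    have "compact (\<sigma> ` K)"
      using local_homeomorphism_continuous[OF \<sigma>] K(1)
      by (intro compact_continuous_image) (auto intro: continuous_on_subset)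
    then show ?case
      using * Suc.IH by (auto simp: fun_eq_iff)
  qed
  then show "ennreal ((transfer_operator \<sigma> \<psi> ^^ n) f x) = (transfer_nn \<sigma> \<psi> ^^ n) (\<lambda>y. ennreal (f y)) x"
    and "0 \<le> (transfer_operator \<sigma> \<psi> ^^ n) f x"
    by (auto dest: fun_cong)
qed

lemma ereal_ln_less_0_iff: "ereal_ln r < 0 \<longleftrightarrow> r < 1"
proof (cases r)
  case (real s)
  then show ?thesis by (auto simp: ereal_ln_def one_ereal_def)
qed (auto simp: ereal_ln_def)

lemma suminf_transfer_nn_finite:
  assumes \<sigma>: "local_homeomorphism \<sigma>" and f: "f \<in> cc_functions" "\<And>y. 0 \<le> f y"
    and P: "pressure_of \<sigma> \<psi> f x < 0"
  shows "(\<Sum>n. (transfer_nn \<sigma> \<psi> ^^ n) (\<lambda>y. ennreal (f y)) x) < \<infinity>"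
proof -
  let ?a = "\<lambda>n. (transfer_operator \<sigma> \<psi> ^^ n) f x"
  note * = transfer_operator_funpow_eq_transfer_nn[OF \<sigma> f, where \<psi> = \<psi> and x = x]
  \<comment> \<open>Non-negativity supplies the norm that the root test asks for. The term at n = 0,
    where \<open>root 0\<close> is 0 by convention, does not affect the limit superior.\<close>
  have "limsup (\<lambda>n. ereal (root n (norm (?a n)))) < 1"
    using P *(2) by (simp add: pressure_of_def ereal_ln_less_0_iff)
  then have "summable ?a" by (rule root_test_convergence')
  then have "(\<Sum>n. ennreal (?a n)) = ennreal (suminf ?a)"
    using *(2) by (intro suminf_ennreal2) auto
  then show ?thesis by (simp add: *(1)[symmetric])
qed

section \<open>Consequences of local compactness: test functions and sigma-finiteness\<close>

text \<open>This ensures that the \<open>SOME\<close> in \<open>pressure_at\<close> really selects a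
  function with the stated properties.\<close>

lemma cc_functions_nonneg_nonzero_exists:
  assumes "locally_compact_space (euclidean :: 'a::t2_space topology)"
  shows "\<exists>f::'a \<Rightarrow> real. f \<in> cc_functions \<and> (\<forall>y. 0 \<le> f y) \<and> (\<exists>y. f y \<noteq> 0)"
proof -
  let ?X = "euclidean :: 'a topology"
  fix x0 :: 'a
  obtain U K where UK: "open U" "compact K" "x0 \<in> U" "U \<subseteq> K"
    using assms unfolding locally_compact_space_def by simp blast
  have "Hausdorff_space ?X"
    unfolding Hausdorff_space_def using hausdorff by (fastforce simp: disjnt_def)
  then have "regular_space ?X"
    by (rule locally_compact_Hausdorff_imp_regular_space[OF assms])
  then have "completely_regular_space ?X"
    using assms by (intro locally_compact_regular_imp_completely_regular_space) auto
  then obtain f :: "'a \<Rightarrow> real" where f: "continuous_map ?X (top_of_set {0..1}) f"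
    "f ` {x0} \<subseteq> {1}" "f ` (- U) \<subseteq> {0}"
    by (rule Urysohn_completely_regular_compact_closed[of 0 1 ?X "{x0}" "- U", rotated]) (use UK in \<open>auto simp: disjnt_def\<close>)
  \<comment> \<open>The Urysohn function vanishes off \<open>U\<close>, which lies in
    \<open>K\<close>, and \<open>K\<close> is closed because the space is Hausdorff.\<close>
  have "closure {x. f x \<noteq> 0} \<subseteq> K"
    using f(3) UK compact_imp_closed[OF UK(2)] by (intro closure_minimal) auto
  then have "compact (closure {x. f x \<noteq> 0})"
    using UK(2) by (metis closed_closure compact_Int_closed inf.absorb_iff2)
  moreover have "continuous_on UNIV f" "\<forall>y. 0 \<le> f y"
    using f(1) by (auto simp: continuous_map_in_subtopology)
  moreover have "f x0 \<noteq> 0" using f(2) by auto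
  ultimately show ?thesis by (auto simp: cc_functions_def)
qed

text \<open>Open sets contained in compact sets cover the space and have finite measure; Lindelof
  makes the cover countable. Sigma-finiteness later yields a strictly positive integrable
  function.\<close>

lemma conformal_measure_sigma_finite:
  fixes \<sigma> :: "'a::{second_countable_topology, t2_space} \<Rightarrow> 'a"
  assumes lc: "locally_compact_space (euclidean :: 'a topology)" and M: "conformal_measure \<sigma> \<phi> M"
  shows "sigma_finite_measure M"
proof
  note sM = conformal_measure_sets[OF M]
  have fin: "emeasure M K < \<infinity>" if "compact K" for K
    using M that by (simp add: conformal_measure_def regular_borel_measure_def)
  define F where "F = {U::'a set. open U \<and> (\<exists>K. compact K \<and> U \<subseteq> K)}"
  obtain F' where F': "F' \<subseteq> F" "countable F'" "\<Union>F' = \<Union>F"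
    by (rule Lindelof[of F]) (auto simp: F_def)
  have "\<Union>F = UNIV"
    using lc unfolding F_def locally_compact_space_def by simp blast
  moreover have "emeasure M U \<noteq> \<infinity>" if "U \<in> F'" for U
  proof -
    have "U \<in> F" using F'(1) that by (rule subsetD)
    then obtain K where K: "compact K" "U \<subseteq> K" unfolding F_def by blast
    then have "emeasure M U \<le> emeasure M K"
      by (intro emeasure_mono) (auto simp: sM borel_compact)
    with fin[OF K(1)] show ?thesis by (auto simp: top_unique)
  qed
  moreover have "F \<subseteq> sets M" by (auto simp: F_def sM)
  ultimately show "\<exists>A. countable A \<and> A \<subseteq> sets M \<and> \<Union>A = space M \<and> (\<forall>a\<in>A. emeasure M a \<noteq> \<infinity>)"
    using F' sets_eq_imp_space_eq[OF sM] by (intro exI[of _ F'] conjI ballI) auto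
qed

theorem proposition5p3:
  fixes \<sigma> :: "'a::{second_countable_topology, t2_space} \<Rightarrow> 'a"
    and \<phi> :: "'a \<Rightarrow> real"
    and m :: "'a measure"
  assumes "locally_compact_space (euclidean :: 'a topology)"
    and "local_homeomorphism \<sigma>"
    and "continuous_on UNIV \<phi>"
    and "cofinal_system \<sigma>"
    and "pressure \<sigma> (\<lambda>x. - \<phi> x) < 0"
    and "conformal_measure \<sigma> \<phi> m"
  shows "dissipative \<sigma> m"
proof -
  note sM[measurable_cong, simp] = conformal_measure_sets[OF assms(6)]
  have spM[simp]: "space m = UNIV" using sets_eq_imp_space_eq[OF sM] by simp
  have \<phi>[measurable]: "\<phi> \<in> borel_measurable borel"
    using assms(3) by (rule borel_measurable_continuous_onI)
  have \<sigma>[measurable]: "\<sigma> \<in> borel_measurable borel"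
    using local_homeomorphism_continuous[OF assms(2)] by (rule borel_measurable_continuous_onI)
  have pow[measurable]: "(\<sigma> ^^ n) \<in> borel_measurable borel" for n
    using \<sigma> by (rule borel_measurable_funpow)
  \<comment> \<open>This is the very function chosen in \<open>pressure_at\<close>, so the bound on
    \<open>pressure\<close> applies to it at every point.\<close>
  define f :: "'a \<Rightarrow> real" where "f = (SOME f. f \<in> cc_functions \<and> (\<forall>y. 0 \<le> f y) \<and> (\<exists>y. f y \<noteq> 0))"
  have f: "f \<in> cc_functions" "\<And>y. 0 \<le> f y" "\<exists>y. f y \<noteq> 0"
    using someI_ex[OF cc_functions_nonneg_nonzero_exists[OF assms(1)]] by (auto simp: f_def)
  have fc: "continuous_on UNIV f" using f(1) by (simp add: cc_functions_def)
  then have [measurable]: "f \<in> borel_measurable borel" by (rule borel_measurable_continuous_onI)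
  define T where "T n = (transfer_nn \<sigma> (\<lambda>x. - \<phi> x) ^^ n) (\<lambda>y. ennreal (f y))" for n
  have T[measurable]: "T n \<in> borel_measurable borel" for n
    unfolding T_def by (rule borel_measurable_transfer_nn_funpow[OF assms(2)]) measurable
  define S where "S x = (\<Sum>n. T n x)" for x
  have [measurable]: "S \<in> borel_measurable borel"
    unfolding S_def by measurable
  have S: "S x < \<infinity>" for x
    unfolding S_def T_def
  proof (rule suminf_transfer_nn_finite[OF assms(2) f(1,2)])
    have "pressure_of \<sigma> (\<lambda>x. - \<phi> x) f x \<le> pressure \<sigma> (\<lambda>x. - \<phi> x)"
      unfolding pressure_def f_def pressure_at_def[symmetric] by (rule SUP_upper) simp
    then show "pressure_of \<sigma> (\<lambda>x. - \<phi> x) f x < 0" using assms(5) by (rule le_less_trans)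
  qed
  obtain h where h[measurable]: "h \<in> borel_measurable m" and hfin: "integral\<^sup>N m h \<noteq> \<infinity>"
    and hpos: "\<And>x. 0 < h x \<and> h x < \<infinity>"
    using sigma_finite_measure.Ex_finite_integrable_function[OF conformal_measure_sigma_finite[OF assms(1,6)]]
    by auto
  \<comment> \<open>The divisor forces S * g \<le> h, so S * g is integrable. It is at least 1 and
    finite because \<open>S\<close> is finite everywhere, so \<open>g\<close> inherits positivity
    and finiteness from \<open>h\<close>.\<close>
  define g where "g x = h x / (1 + S x)" for x
  have g[measurable]: "g \<in> borel_measurable borel"
  proof -
    have "g \<in> borel_measurable m" unfolding g_def by measurable
    then show ?thesis by (simp add: measurable_cong_sets[OF sM refl])
  qed
  have gpos: "0 < g x" and gfin: "g x \<noteq> \<infinity>" for x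
    using hpos[of x] S[of x] by (auto simp: g_def ennreal_zero_less_divide ennreal_divide_eq_top_iff)
  define G where "G x = (\<Sum>n. g ((\<sigma> ^^ n) x))" for x
  have [measurable]: "G \<in> borel_measurable borel"
    unfolding G_def by measurable
  have step: "G x = g x + G (\<sigma> x)" for x
    unfolding G_def by (rule suminf_funpow_rec)
  \<comment> \<open>Tonelli and duality, used term by term, turn the integral of f * G into that of
    S * g.\<close>
  have "(\<integral>\<^sup>+x. ennreal (f x) * G x \<partial>m) = (\<Sum>n. \<integral>\<^sup>+x. ennreal (f x) * g ((\<sigma> ^^ n) x) \<partial>m)"
    unfolding G_def ennreal_suminf_cmult[symmetric] by (rule nn_integral_suminf) measurable
  also have "\<dots> = (\<Sum>n. \<integral>\<^sup>+x. T n x * g x \<partial>m)"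
    unfolding T_def by (subst nn_integral_transfer_nn_funpow[OF assms(2,6)]) auto
  also have "\<dots> = (\<integral>\<^sup>+x. S x * g x \<partial>m)"
    unfolding S_def ennreal_suminf_multc[symmetric] by (rule nn_integral_suminf[symmetric]) measurable
  also have "\<dots> \<le> (\<integral>\<^sup>+x. h x \<partial>m)"
  proof (rule nn_integral_mono)
    fix x
    have "S x * g x \<le> (1 + S x) * g x" by (intro mult_right_mono) auto
    also have "\<dots> = h x"
      using S[of x] by (simp add: g_def ennreal_times_divide mult_divide_eq_ennreal mult.commute less_top)
    finally show "S x * g x \<le> h x" .
  qed
  finally have "(\<integral>\<^sup>+x. ennreal (f x) * G x \<partial>m) \<noteq> \<infinity>"
    using hfin by (auto simp: top_unique)
  then have AE: "AE x in m. ennreal (f x) * G x \<noteq> \<infinity>"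
    by (rule nn_integral_noteq_infinite[rotated]) measurable
  define E where "E = {x. G x = \<infinity>}"
  define U where "U = {x. f x \<noteq> 0}"
  have "{x\<in>space borel. G x = \<infinity>} \<in> sets borel" by measurable
  then have E: "E \<in> sets borel" by (simp add: E_def)
  have U: "open U" "U \<noteq> {}"
    using f(3) open_Collect_neq[OF fc continuous_on_const] by (auto simp: U_def)
  have "E \<inter> U \<in> null_sets m"
  proof -
    have "AE x in m. x \<notin> E \<inter> U"
      using AE
    proof eventually_elim
      \<comment> \<open>Finiteness of f * G bounds \<open>G\<close> only where \<open>f\<close> is
        positive, since 0 times infinity is 0; hence the restriction to \<open>U\<close>.\<close>
      case (elim x)
      have "0 < f x" if "x \<in> U"
        using f(2)[of x] that by (simp add: U_def)
      with elim show ?case by (auto simp: E_def ennreal_mult_top)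
    qed
    moreover have "E \<inter> U \<in> sets m" using E U(1) by simp
    ultimately show ?thesis by (simp add: AE_iff_null_sets)
  qed
  \<comment> \<open>As \<open>g\<close> is finite, G = g + G \<circ> \<sigma> is infinite at
    \<open>x\<close> exactly when \<open>G\<close> is infinite at \<sigma> x.\<close>
  moreover have "\<sigma> x \<in> E \<longleftrightarrow> x \<in> E" for x
    using step[of x] gfin[of x] by (auto simp: E_def)
  ultimately have "E \<in> null_sets m"
    using conformal_measure_null_cofinal[OF assms(2,4,6) \<phi> E _ U] by blast
  moreover obtain W :: "nat \<Rightarrow> 'a set" where W: "\<forall>n. wandering \<sigma> (W n)" "{x. G x < \<infinity>} = (\<Union>n. W n)"
    using birkhoff_finite_wandering_cover[OF \<sigma> g gpos] unfolding G_def by blast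
  moreover have "UNIV - {x. G x < \<infinity>} = E"
    by (auto simp: E_def less_top[symmetric])
  ultimately show ?thesis
    unfolding dissipative_iff_wandering_cover[OF sM] by metis
qed

end
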